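(* Let $\varphi:(0,1)\to(0,\infty)$ be a measurable function. Let $I\subset[0,\infty)$ be an interval with interior $I^0$, let $f:I\to\mathbb{R}$ be twice differentiable on $I^0$, and let $a,b\in I^0$ with $a<b$ be such that $f''\in L_1[a,b]$. Suppose that $|f''|^q$ is $\varphi$-convex on $[a,b]$ for some fixed $q\ge 1$. Then for every $x\in[a,b]$, $\lambda\in[0,1]$ and $\alpha>0$, $$\begin{aligned}|S_f(x,\lambda,\alpha;a,b)|\le A_1(\alpha,\lambda)^{1-\frac1q}\Big[&\tfrac{(x-a)^{\alpha+2}}{b-a}\big\{A_2(\alpha,\lambda,\varphi)|f''(x)|^q+A_3(\alpha,\lambda,\varphi)|f''(a)|^q\big\}^{\frac1q}\\&+\tfrac{(b-x)^{\alpha+2}}{b-a}\big\{A_2(\alpha,\lambda,\varphi)|f''(x)|^q+A_3(\alpha,\lambda,\varphi)|f''(b)|^q\big\}^{\frac1q}\Big],\end{aligned}$$ where $$A_1(\alpha,\lambda)=\frac{\alpha\lambda^{1+\frac2\alpha}+1}{\alpha+2}-\frac\lambda2,$$ $$A_2(\alpha,\lambda,\varphi)=\int_0^1|t(\lambda-t^\alpha)|\,t\varphi(t)\,dt,\qquad A_3(\alpha,\lambda,\varphi)=\int_0^1|t(\lambda-t^\alpha)|\,(1-t)\varphi(1-t)\,dt.$$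
   Context: $\varphi$-convexity: given a measurable $\varphi:(0,1)\to(0,\infty)$, a function $g:J\to[0,\infty)$ on an interval $J$ is $\varphi$-convex on $J$ if for all $u,v\in J$ and all $t\in(0,1)$, $g(tu+(1-t)v)\le t\varphi(t)g(u)+(1-t)\varphi(1-t)g(v)$. For $x\in[a,b]$, $\lambda\in[0,1]$, $\alpha>0$, $$\begin{aligned}S_f(x,\lambda,\alpha;a,b)={}&(1-\lambda)\frac{(b-x)^{\alpha+1}-(x-a)^{\alpha+1}}{b-a}f'(x)+(1+\alpha-\lambda)\frac{(x-a)^\alpha+(b-x)^\alpha}{b-a}f(x)\\&+\lambda\frac{(x-a)^\alpha f(a)+(b-x)^\alpha f(b)}{b-a}-\frac{\Gamma(\alpha+2)}{b-a}\big\{J_{x^-}^\alpha f(a)+J_{x^+}^\alpha f(b)\big\},\end{aligned}$$ where the Riemann–Liouville fractional integrals are $$J_{x^-}^\alpha f(a)=\frac1{\Gamma(\alpha)}\int_a^x(t-a)^{\alpha-1}f(t)\,dt,\qquad J_{x^+}^\alpha f(b)=\frac1{\Gamma(\alpha)}\int_x^b(b-t)^{\alpha-1}f(t)\,dt.$$ Integrals of nonnegative measurable functions involving $\varphi$ are understood with values in $[0,\infty]$, with $0\cdot\infty=0$. *)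

theory Defs
  imports "HOL-Analysis.Analysis"
begin

definition phi_convex_on :: "(real \<Rightarrow> real) \<Rightarrow> real set \<Rightarrow> (real \<Rightarrow> real) \<Rightarrow> bool" where
  "phi_convex_on \<phi> J g \<longleftrightarrow>
     is_interval J \<and> (\<forall>u\<in>J. 0 \<le> g u) \<and>
     (\<forall>u\<in>J. \<forall>v\<in>J. \<forall>t\<in>{0<..<1}.
        g (t * u + (1 - t) * v) \<le> t * \<phi> t * g u + (1 - t) * \<phi> (1 - t) * g v)"

(* RL_minus \<alpha> x f s is the Riemann-Liouville integral based at x and evaluated at s \<le> x;
   RL_plus \<alpha> x f s is the one evaluated at s \<ge> x. *)
definition RL_minus :: "real \<Rightarrow> real \<Rightarrow> (real \<Rightarrow> real) \<Rightarrow> real \<Rightarrow> real" where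
  "RL_minus \<alpha> x f s =
     1 / Gamma \<alpha> * set_lebesgue_integral lebesgue {s..x} (\<lambda>t. (t - s) powr (\<alpha> - 1) * f t)"

definition RL_plus :: "real \<Rightarrow> real \<Rightarrow> (real \<Rightarrow> real) \<Rightarrow> real \<Rightarrow> real" where
  "RL_plus \<alpha> x f s =
     1 / Gamma \<alpha> * set_lebesgue_integral lebesgue {x..s} (\<lambda>t. (s - t) powr (\<alpha> - 1) * f t)"

definition S_frac :: "(real \<Rightarrow> real) \<Rightarrow> real \<Rightarrow> real \<Rightarrow> real \<Rightarrow> real \<Rightarrow> real \<Rightarrow> real" where
  "S_frac f x l \<alpha> a b =
     (1 - l) * (((b - x) powr (\<alpha> + 1) - (x - a) powr (\<alpha> + 1)) / (b - a)) * deriv f x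
     + (1 + \<alpha> - l) * (((x - a) powr \<alpha> + (b - x) powr \<alpha>) / (b - a)) * f x
     + l * (((x - a) powr \<alpha> * f a + (b - x) powr \<alpha> * f b) / (b - a))
     - Gamma (\<alpha> + 2) / (b - a) * (RL_minus \<alpha> x f a + RL_plus \<alpha> x f b)"

definition A1 :: "real \<Rightarrow> real \<Rightarrow> real" where
  "A1 \<alpha> l = (\<alpha> * l powr (1 + 2 / \<alpha>) + 1) / (\<alpha> + 2) - l / 2"

definition A2 :: "real \<Rightarrow> real \<Rightarrow> (real \<Rightarrow> real) \<Rightarrow> ennreal" where
  "A2 \<alpha> l \<phi> =
     set_nn_integral lebesgue {0<..<1} (\<lambda>t. ennreal (\<bar>t * (l - t powr \<alpha>)\<bar> * (t * \<phi> t)))"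

definition A3 :: "real \<Rightarrow> real \<Rightarrow> (real \<Rightarrow> real) \<Rightarrow> ennreal" where
  "A3 \<alpha> l \<phi> =
     set_nn_integral lebesgue {0<..<1}
       (\<lambda>t. ennreal (\<bar>t * (l - t powr \<alpha>)\<bar> * ((1 - t) * \<phi> (1 - t))))"

(* Real powers on [0,\<infinity>]; meaningful for exponents p > 0 only. *)
definition ennreal_powr :: "ennreal \<Rightarrow> real \<Rightarrow> ennreal" where
  "ennreal_powr y p = (if y = \<infinity> then \<infinity> else ennreal (enn2real y powr p))"

end

theory Submission
  imports Defs
begin

text \<open>
  Let \<open>k t = t * (l - t powr \<alpha>)\<close>, so that \<open>k 0 = 0\<close> and \<open>k'' t = - \<alpha> * (\<alpha> + 1) * t powr (\<alpha> - 1)\<close>: up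
  to a constant the second derivative of the kernel is the weight of the Riemann-Liouville
  integral of order \<open>\<alpha>\<close>. Integrating \<open>k t * f'' (t * x + (1 - t) * c)\<close> over the unit interval by
  parts twice (\<open>kernel_by_parts\<close>) therefore yields the value of \<open>f'\<close> at \<open>x\<close> (not at \<open>c\<close>,
  because \<open>k 0 = 0\<close>), the values of \<open>f\<close> at \<open>x\<close> and \<open>c\<close>, and a fractional integral. Taking \<open>c = a\<close> and \<open>c = b\<close> and adding, with weights
  \<open>(x - a) powr (\<alpha> + 2) / (b - a)\<close> and \<open>(b - x) powr (\<alpha> + 2) / (b - a)\<close>, gives exactly \<open>S_frac\<close>.

  It remains to estimate the two integrals. The mass of \<open>\<bar>k\<bar>\<close> is \<open>A1 \<alpha> l\<close>
  (\<open>kernel_has_integral\<close>), so the power mean inequality with weight \<open>\<bar>k\<bar>\<close>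
  (\<open>weighted_power_mean\<close>) bounds each of them by \<open>A1 \<alpha> l powr (1 - 1 / q)\<close> times the \<open>q\<close>-th root of
  the integral of \<open>\<bar>k t\<bar> * \<bar>f'' (t * x + (1 - t) * c)\<bar> powr q\<close>. The convexity hypothesis bounds the
  last factor by \<open>t * \<phi> t * \<bar>f'' x\<bar> powr q + (1 - t) * \<phi> (1 - t) * \<bar>f'' c\<bar> powr q\<close>, and the integrals
  of the two terms against \<open>\<bar>k\<bar>\<close> are by definition \<open>A2\<close> and \<open>A3\<close> times constants
  (\<open>kernel_integral_bound\<close>).
\<close>

section \<open>A weighted power mean inequality\<close>

text \<open>
  By convexity the graph of the \<open>q\<close>-th power lies above its tangent at \<open>s\<close>; solving that
  inequality for \<open>g\<close> gives the bound, which is read off here from Young's inequality. Its point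
  is to be affine in \<open>g powr q\<close>, so that it can be integrated term by term.
\<close>

lemma powr_tangent_bound:
  fixes g s q :: real
  assumes "1 \<le> q" "0 \<le> g" "0 < s"
  shows "g \<le> s powr (1 - q) / q * g powr q + (1 - 1 / q) * s"
proof (cases "g = 0")
  case True
  then show ?thesis using assms by simp
next
  case False
  with assms have g: "g > 0" by simp
  have "(g powr q * s powr (1 - q)) powr (1 / q) * s powr (1 - 1 / q)
      \<le> 1 / q * (g powr q * s powr (1 - q)) + (1 - 1 / q) * s"
    using assms g by (intro Youngs_inequality_0) auto
  moreover have "(g powr q * s powr (1 - q)) powr (1 / q) * s powr (1 - 1 / q)
      = g * (s powr ((1 - q) / q) * s powr (1 - 1 / q))"
    using assms g by (simp add: powr_mult powr_powr)
  moreover have "s powr ((1 - q) / q) * s powr (1 - 1 / q) = 1"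
    using assms by (simp add: powr_add [symmetric] diff_divide_distrib)
  ultimately show ?thesis by (simp only: mult_1_right) (simp add: algebra_simps)
qed

lemma ennreal_mult_add_mult:
  assumes "0 \<le> a" "0 \<le> b" "0 \<le> c" "0 \<le> d"
  shows "ennreal (a * b + c * d) = ennreal a * ennreal b + ennreal c * ennreal d"
  using assms by (simp add: ennreal_plus ennreal_mult)

text \<open>
  Hoelder's inequality for the measure with density \<open>w\<close>, whose total mass \<open>A\<close> is positive and
  finite. Integrating the tangent bound against \<open>w\<close> bounds the left-hand side by a function of the
  free parameter \<open>s\<close>; the minimum, at \<open>s = (C / A) powr (1 / q)\<close>, is the right-hand side. An
  infinite \<open>C\<close> makes the right-hand side infinite because \<open>A\<close> is positive.
\<close>

lemma weighted_power_mean: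
  fixes w g :: "'a \<Rightarrow> real" and A q :: real
  assumes [measurable]: "w \<in> borel_measurable M" "g \<in> borel_measurable M"
    and w: "\<And>t. t \<in> space M \<Longrightarrow> 0 \<le> w t" and g: "\<And>t. t \<in> space M \<Longrightarrow> 0 \<le> g t"
    and q: "1 \<le> q" and A: "0 < A"
    and wA: "(\<integral>\<^sup>+t. ennreal (w t) \<partial>M) = ennreal A"
    and C: "(\<integral>\<^sup>+t. ennreal (w t * g t powr q) \<partial>M) \<le> C"
  shows "(\<integral>\<^sup>+t. ennreal (w t * g t) \<partial>M) \<le> ennreal (A powr (1 - 1 / q)) * ennreal_powr C (1 / q)"
proof (cases "C = \<infinity>")
  case True
  then show ?thesis using A by (simp add: ennreal_powr_def ennreal_mult_top)
next
  case False
  then obtain c where c: "C = ennreal c" "0 \<le> c" by (cases C) auto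
  have bound: "(\<integral>\<^sup>+t. ennreal (w t * g t) \<partial>M)
      \<le> ennreal (s powr (1 - q) / q * c + (1 - 1 / q) * s * A)" if s: "0 < s" for s
  proof -
    let ?u = "s powr (1 - q) / q" and ?v = "(1 - 1 / q) * s"
    have uv: "0 \<le> ?u" "0 \<le> ?v" using q s by auto
    have "(\<integral>\<^sup>+t. ennreal (w t * g t) \<partial>M)
        \<le> (\<integral>\<^sup>+t. ennreal ?u * ennreal (w t * g t powr q) + ennreal ?v * ennreal (w t) \<partial>M)"
    proof (rule nn_integral_mono)
      fix t assume t: "t \<in> space M"
      have "w t * g t \<le> w t * (?u * g t powr q + ?v)"
        using powr_tangent_bound[OF q g[OF t] s] w[OF t] by (rule mult_left_mono)
      also have "\<dots> = ?u * (w t * g t powr q) + ?v * w t"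
        by (simp add: algebra_simps)
      finally have "ennreal (w t * g t) \<le> ennreal (?u * (w t * g t powr q) + ?v * w t)"
        by (rule ennreal_leI)
      also have "\<dots> = ennreal ?u * ennreal (w t * g t powr q) + ennreal ?v * ennreal (w t)"
        using uv w[OF t] by (intro ennreal_mult_add_mult) auto
      finally show "ennreal (w t * g t) \<le>
          ennreal ?u * ennreal (w t * g t powr q) + ennreal ?v * ennreal (w t)" .
    qed
    also have "\<dots> = ennreal ?u * (\<integral>\<^sup>+t. ennreal (w t * g t powr q) \<partial>M) + ennreal ?v * ennreal A"
      by (simp add: nn_integral_add nn_integral_cmult wA)
    also have "\<dots> \<le> ennreal ?u * ennreal c + ennreal ?v * ennreal A"
      using C c by (intro add_right_mono mult_left_mono) auto
    also have "\<dots> = ennreal (?u * c + ?v * A)"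
      using uv c A by (intro ennreal_mult_add_mult [symmetric]) auto
    finally show ?thesis .
  qed
  show ?thesis
  proof (cases "c = 0")
    case True
    \<comment> \<open>The optimal \<open>s\<close> would be \<open>0\<close>, which is not admissible; let \<open>s\<close> tend to \<open>0\<close> instead.\<close>
    have "(\<integral>\<^sup>+t. ennreal (w t * g t) \<partial>M) \<le> 0"
    proof (rule ennreal_le_epsilon)
      fix e :: real assume e: "0 < e"
      have "(1 - 1 / q) * (e / A) * A \<le> e" using q A e by (simp add: field_simps)
      then show "(\<integral>\<^sup>+t. ennreal (w t * g t) \<partial>M) \<le> 0 + ennreal e"
        using bound[of "e / A"] e A True by (auto intro: order_trans ennreal_leI)
    qed
    then show ?thesis by (metis order_trans zero_le)
  next
    case False
    then have cpos: "c > 0" using c by simp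
    \<comment> \<open>The value of \<open>s\<close> that minimizes the bound.\<close>
    let ?s = "(c / A) powr (1 / q)"
    have 1: "?s * A = A powr (1 - 1 / q) * c powr (1 / q)"
      using A cpos by (simp add: powr_divide powr_diff)
    have "?s powr (1 - q) * c = (c / A) powr (1 / q - 1) * c"
      using q by (simp add: powr_powr diff_divide_distrib)
    also have "\<dots> = ?s * A"
      using A cpos by (simp add: powr_diff)
    finally have 2: "?s powr (1 - q) * c = ?s * A" .
    have "?s powr (1 - q) / q * c + (1 - 1 / q) * ?s * A
        = (?s powr (1 - q) * c) / q + (1 - 1 / q) * (?s * A)" by simp
    also have "\<dots> = ?s * A" unfolding 2 by (simp add: algebra_simps)
    finally have "(\<integral>\<^sup>+t. ennreal (w t * g t) \<partial>M) \<le> ennreal (A powr (1 - 1 / q) * c powr (1 / q))"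
      using bound[of ?s] A cpos 1 by simp
    then show ?thesis using c by (simp add: ennreal_powr_def ennreal_mult)
  qed
qed

section \<open>The kernel\<close>

text \<open>
  On the unit interval the kernel is nonnegative up to \<open>c = l powr (1 / \<alpha>)\<close> and nonpositive
  from there on. Hence, with the antiderivative \<open>K\<close> that vanishes at \<open>0\<close>, the integral of its
  absolute value is \<open>2 * K c - K 1\<close>.
\<close>

lemma kernel_has_integral:
  assumes l: "l \<in> {0..1}" and \<alpha>: "0 < \<alpha>"
  shows "((\<lambda>t. \<bar>t * (l - t powr \<alpha>)\<bar>) has_integral A1 \<alpha> l) {0..1}"
proof -
  define c where "c = l powr (1 / \<alpha>)"
  define K where "K = (\<lambda>t. l * t\<^sup>2 / 2 - t powr (\<alpha> + 2) / (\<alpha> + 2))"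
  have c: "0 \<le> c" "c \<le> 1" using l \<alpha> by (auto simp: c_def powr_le1)
  have c\<alpha>: "c powr \<alpha> = l" using l \<alpha> by (simp add: c_def powr_powr)
  have contK: "continuous_on S K" if "S \<subseteq> {0..}" for S
    unfolding K_def using \<alpha> that by (auto intro!: continuous_intros continuous_on_powr')
  have derK: "(K has_vector_derivative t * (l - t powr \<alpha>)) (at t)" if "0 < t" for t
  proof -
    have "((\<lambda>t. t powr (\<alpha> + 2) / (\<alpha> + 2)) has_real_derivative
        (\<alpha> + 2) * t powr (\<alpha> + 2 - 1) / (\<alpha> + 2)) (at t)"
      by (intro DERIV_cdivide has_real_derivative_powr that)
    moreover have "(\<alpha> + 2) * t powr (\<alpha> + 2 - 1) / (\<alpha> + 2) = t * t powr \<alpha>"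
      using that \<alpha> by (simp add: powr_mult_base add.commute)
    moreover have "((\<lambda>t. l * t\<^sup>2 / 2) has_real_derivative l * t) (at t)"
      by (auto intro!: derivative_eq_intros)
    ultimately have "(K has_real_derivative l * t - t * t powr \<alpha>) (at t)"
      unfolding K_def by (auto intro: DERIV_diff)
    then show ?thesis
      by (simp add: has_real_derivative_iff_has_vector_derivative algebra_simps)
  qed
  have "((\<lambda>t. t * (l - t powr \<alpha>)) has_integral K c - K 0) {0..c}"
    using c by (intro fundamental_theorem_of_calculus_interior contK derK) auto
  then have 1: "((\<lambda>t. \<bar>t * (l - t powr \<alpha>)\<bar>) has_integral K c - K 0) {0..c}"
  proof (rule has_integral_eq[rotated])
    fix t assume t: "t \<in> {0..c}"
    then have "t powr \<alpha> \<le> c powr \<alpha>" using \<alpha> by (intro powr_mono2) auto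
    then show "t * (l - t powr \<alpha>) = \<bar>t * (l - t powr \<alpha>)\<bar>" using t c\<alpha> by simp
  qed
  have "((\<lambda>t. t * (l - t powr \<alpha>)) has_integral K 1 - K c) {c..1}"
    using c by (intro fundamental_theorem_of_calculus_interior contK derK) auto
  then have "((\<lambda>t. - (t * (l - t powr \<alpha>))) has_integral - (K 1 - K c)) {c..1}"
    by (rule has_integral_neg)
  then have 2: "((\<lambda>t. \<bar>t * (l - t powr \<alpha>)\<bar>) has_integral - (K 1 - K c)) {c..1}"
  proof (rule has_integral_eq[rotated])
    fix t assume t: "t \<in> {c..1}"
    then have "c powr \<alpha> \<le> t powr \<alpha>" using \<alpha> c by (intro powr_mono2) auto
    then show "- (t * (l - t powr \<alpha>)) = \<bar>t * (l - t powr \<alpha>)\<bar>"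
      using t c c\<alpha> by (simp add: abs_mult) (simp add: right_diff_distrib)
  qed
  have "(K c - K 0) + - (K 1 - K c) = A1 \<alpha> l"
  proof -
    have c2: "c\<^sup>2 = l powr (2 / \<alpha>)"
      using c powr_powr[of l "1 / \<alpha>" 2] by (simp add: c_def)
    have e: "l * l powr (2 / \<alpha>) = l powr (1 + 2 / \<alpha>)"
      using l by (simp add: powr_mult_base)
    have "c powr (\<alpha> + 2) = c powr \<alpha> * c\<^sup>2"
      using c by (simp add: powr_add)
    then have "K c = l powr (1 + 2 / \<alpha>) * (1 / 2 - 1 / (\<alpha> + 2))"
      by (simp add: K_def c\<alpha> c2 e algebra_simps)
    moreover have "K 0 = 0" using \<alpha> by (simp add: K_def)
    moreover have "K 1 = l / 2 - 1 / (\<alpha> + 2)" by (simp add: K_def)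
    ultimately show ?thesis using \<alpha> unfolding A1_def by (simp add: field_simps)
  qed
  then show ?thesis
    using has_integral_combine[OF c 1 2] by simp
qed

lemma kernel_measurable [measurable]:
  "(\<lambda>t::real. t * (l - t powr \<alpha>)) \<in> borel_measurable (lebesgue_on S)"
  by (intro measurable_restrict_space1 measurable_completion) measurable

lemma continuous_on_kernel:
  assumes "0 < \<alpha>"
  shows "continuous_on {0..1} (\<lambda>t::real. t * (l - t powr \<alpha>))"
  using assms by (auto intro!: continuous_intros continuous_on_powr')

text \<open>
  Positivity makes the factor in front of the power mean nonzero: for \<open>q = 1\<close> it must be \<open>1\<close>
  although \<open>0 powr 0 = 0\<close>, and where \<open>A2\<close> or \<open>A3\<close> is infinite it keeps the product infinite.
  A vanishing integral would force the continuous kernel to vanish on the whole interval, and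
  the points \<open>1\<close> and \<open>1 / 2\<close> already exclude that.
\<close>

lemma A1_pos:
  assumes l: "l \<in> {0..1}" and \<alpha>: "0 < \<alpha>"
  shows "0 < A1 \<alpha> l"
proof -
  have "0 \<le> A1 \<alpha> l"
    using kernel_has_integral[OF assms] by (rule has_integral_nonneg) simp
  moreover have "A1 \<alpha> l \<noteq> 0"
  proof
    assume "A1 \<alpha> l = 0"
    then have "((\<lambda>t. \<bar>t * (l - t powr \<alpha>)\<bar>) has_integral 0) (cbox 0 1)"
      using kernel_has_integral[OF assms] by simp
    then have z: "\<bar>t * (l - t powr \<alpha>)\<bar> = 0" if "t \<in> cbox 0 1" for t
      using that by (intro has_integral_0_cbox_imp_0[of 0 1 "\<lambda>t. \<bar>t * (l - t powr \<alpha>)\<bar>" t])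
        (auto simp: box_real intro!: continuous_on_rabs continuous_on_kernel \<alpha>)
    have "l = 1" using z[of 1] by simp
    moreover have "l = (1/2) powr \<alpha>" using z[of "1/2"] by simp
    moreover have "(1/2::real) powr \<alpha> < 1" using \<alpha> powr_less_mono2[of \<alpha> "1/2" 1] by simp
    ultimately show False by simp
  qed
  ultimately show ?thesis by simp
qed

lemma kernel_nn_integral:
  assumes l: "l \<in> {0..1}" and \<alpha>: "0 < \<alpha>"
  shows "(\<integral>\<^sup>+t. ennreal \<bar>t * (l - t powr \<alpha>)\<bar> \<partial>lebesgue_on {0<..<1}) = ennreal (A1 \<alpha> l)"
proof -
  have "((\<lambda>t. \<bar>t * (l - t powr \<alpha>)\<bar>) has_integral A1 \<alpha> l) {0<..<1}"
    using kernel_has_integral[OF assms] by (simp add: has_integral_Icc_iff_Ioo)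
  from nn_integral_has_integral_lebesgue'[OF _ this] show ?thesis
    by (simp add: nn_integral_restrict_space nn_integral_completion)
qed

text \<open>
  Write \<open>k t = t * (l - t powr \<alpha>)\<close>. Instead of integrating by parts twice, one applies the
  fundamental theorem once, to \<open>k * F' - k' * F\<close>, whose derivative is \<open>k * F'' - k'' * F\<close> with
  \<open>- k'' t = \<alpha> * (\<alpha> + 1) * t powr (\<alpha> - 1)\<close>. Derivatives are only taken in the open interval, since
  \<open>k'\<close> need not be differentiable at \<open>0\<close>, and \<open>F''\<close> need not be continuous: the theorem gives a
  Henstock-Kurzweil integral, which splits because both summands are absolutely integrable.
\<close>

lemma kernel_by_parts:
  fixes F F' F'' :: "real \<Rightarrow> real"
  assumes \<alpha>: "0 < \<alpha>"
    and contF: "continuous_on {0..1} F" and contF': "continuous_on {0..1} F'"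
    and derF: "\<And>t. 0 < t \<Longrightarrow> t < 1 \<Longrightarrow> (F has_real_derivative F' t) (at t)"
    and derF': "\<And>t. 0 < t \<Longrightarrow> t < 1 \<Longrightarrow> (F' has_real_derivative F'' t) (at t)"
    and intF'': "F'' absolutely_integrable_on {0..1}"
  shows "(\<lambda>t. t * (l - t powr \<alpha>) * F'' t) absolutely_integrable_on {0..1}"
    and "(\<lambda>t. t powr (\<alpha> - 1) * F t) absolutely_integrable_on {0..1}"
    and "integral {0..1} (\<lambda>t. t * (l - t powr \<alpha>) * F'' t) =
      (l - 1) * F' 1 + (1 + \<alpha> - l) * F 1 + l * F 0
      - \<alpha> * (\<alpha> + 1) * integral {0..1} (\<lambda>t. t powr (\<alpha> - 1) * F t)"
proof -
  let ?k = "\<lambda>t. t * (l - t powr \<alpha>)"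
  let ?k' = "\<lambda>t. l - (\<alpha> + 1) * t powr \<alpha>"
  show 1: "(\<lambda>t. ?k t * F'' t) absolutely_integrable_on {0..1}"
    using compact_imp_bounded[OF compact_continuous_image[OF continuous_on_kernel[OF \<alpha>]]]
    by (intro absolutely_integrable_bounded_measurable_product_real intF'' kernel_measurable) auto
  have "(\<lambda>t. t powr (\<alpha> - 1)) absolutely_integrable_on {0..1}"
    using has_integral_powr_from_0[of "\<alpha> - 1" 1] \<alpha>
    by (intro nonnegative_absolutely_integrable_1) (auto simp: integrable_on_def)
  then have "(\<lambda>t. F t * t powr (\<alpha> - 1)) absolutely_integrable_on {0..1}"
    using compact_imp_bounded[OF compact_continuous_image[OF contF]]
    by (intro absolutely_integrable_bounded_measurable_product_real
        continuous_imp_measurable_on_sets_lebesgue contF) auto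
  then show 2: "(\<lambda>t. t powr (\<alpha> - 1) * F t) absolutely_integrable_on {0..1}"
    by (simp add: mult.commute)
  let ?G = "\<lambda>t. ?k t * F' t - ?k' t * F t"
  have "((\<lambda>t. ?k t * F'' t + \<alpha> * (\<alpha> + 1) * (t powr (\<alpha> - 1) * F t)) has_integral ?G 1 - ?G 0) {0..1}"
  proof (rule fundamental_theorem_of_calculus_interior)
    show "continuous_on {0..1} ?G"
      using \<alpha> by (intro continuous_intros contF contF' continuous_on_powr') auto
    fix t :: real assume t: "t \<in> {0<..<1}"
    have "t powr \<alpha> = t * t powr (\<alpha> - 1)" using t by (simp add: powr_diff)
    then show "(?G has_vector_derivative ?k t * F'' t + \<alpha> * (\<alpha> + 1) * (t powr (\<alpha> - 1) * F t)) (at t)"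
      unfolding has_real_derivative_iff_has_vector_derivative[symmetric] using t
      by (auto intro!: derivative_eq_intros derF derF' simp: algebra_simps)
  qed simp
  then have "integral {0..1} (\<lambda>t. ?k t * F'' t + \<alpha> * (\<alpha> + 1) * (t powr (\<alpha> - 1) * F t)) = ?G 1 - ?G 0"
    by (rule integral_unique)
  moreover have "integral {0..1} (\<lambda>t. ?k t * F'' t + \<alpha> * (\<alpha> + 1) * (t powr (\<alpha> - 1) * F t))
      = integral {0..1} (\<lambda>t. ?k t * F'' t)
      + \<alpha> * (\<alpha> + 1) * integral {0..1} (\<lambda>t. t powr (\<alpha> - 1) * F t)"
    using 1 2 by (subst integral_add) (auto intro: set_lebesgue_integral_eq_integral)
  ultimately show "integral {0..1} (\<lambda>t. ?k t * F'' t) =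
      (l - 1) * F' 1 + (1 + \<alpha> - l) * F 1 + l * F 0
      - \<alpha> * (\<alpha> + 1) * integral {0..1} (\<lambda>t. t powr (\<alpha> - 1) * F t)"
    using \<alpha> by (simp add: algebra_simps)
qed

section \<open>The estimate on the unit interval\<close>

text \<open>
  Lebesgue measurability is not preserved by composition with arbitrary Borel maps, but it
  is by affine ones, whose preimages of null sets are null.
\<close>

lemma measurable_reflect_unit_interval:
  assumes "\<phi> \<in> borel_measurable (lebesgue_on {0<..<1::real})"
  shows "(\<lambda>t. \<phi> (1 - t)) \<in> borel_measurable (lebesgue_on {0<..<1})"
proof -
  have "(\<lambda>t::real. 1 + (\<Sum>j\<in>Basis. (-1 * (t \<bullet> j)) *\<^sub>R j)) \<in> lebesgue \<rightarrow>\<^sub>M lebesgue"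
    by (rule lebesgue_affine_measurable) auto
  then have "(\<lambda>t::real. 1 - t) \<in> lebesgue \<rightarrow>\<^sub>M lebesgue" by simp
  then have "(\<lambda>t::real. 1 - t) \<in> lebesgue_on {0<..<1} \<rightarrow>\<^sub>M lebesgue_on {0<..<1}"
    by (rule measurable_restrict_space3) auto
  from measurable_compose[OF this assms] show ?thesis .
qed

text \<open>
  The power mean inequality with weight \<open>\<bar>k\<bar>\<close>, of mass \<open>A1 \<alpha> l\<close>, leaves the integral of
  \<open>\<bar>k\<bar> * \<bar>G\<bar> powr q\<close>; inserting the convexity bound for \<open>\<bar>G\<bar> powr q\<close> splits it into the
  integrals \<open>A2\<close> and \<open>A3\<close>. Both may be infinite, so this part is carried out in \<open>[0, \<infinity>]\<close>.
\<close>

lemma kernel_integral_bound: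
  fixes G \<phi> :: "real \<Rightarrow> real"
  assumes \<phi>: "\<phi> \<in> borel_measurable (lebesgue_on {0<..<1})" "\<forall>t\<in>{0<..<1}. 0 < \<phi> t"
    and l: "l \<in> {0..1}" and \<alpha>: "0 < \<alpha>" and q: "1 \<le> q"
    and uv: "0 \<le> u" "0 \<le> v"
    and G: "G absolutely_integrable_on {0..1}"
    and conv: "\<And>t. 0 < t \<Longrightarrow> t < 1 \<Longrightarrow>
      \<bar>G t\<bar> powr q \<le> t * \<phi> t * u + (1 - t) * \<phi> (1 - t) * v"
    and kG: "(\<lambda>t. t * (l - t powr \<alpha>) * G t) absolutely_integrable_on {0..1}"
  shows "ennreal \<bar>integral {0..1} (\<lambda>t. t * (l - t powr \<alpha>) * G t)\<bar> \<le>
    ennreal (A1 \<alpha> l powr (1 - 1 / q)) *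
      ennreal_powr (A2 \<alpha> l \<phi> * ennreal u + A3 \<alpha> l \<phi> * ennreal v) (1 / q)"
proof -
  let ?k = "\<lambda>t. t * (l - t powr \<alpha>)" and ?M = "lebesgue_on {0<..<1::real}"
  note [measurable] = \<phi>(1) measurable_reflect_unit_interval[OF \<phi>(1)]
  have [measurable]: "(\<lambda>t. t) \<in> borel_measurable ?M"
    by (intro measurable_restrict_space1 measurable_completion) measurable
  have "set_integrable lebesgue {0<..<1} G"
    using G by (rule set_integrable_subset) auto
  then have "integrable ?M G"
    by (simp add: integrable_restrict_space set_integrable_def)
  then have [measurable]: "G \<in> borel_measurable ?M" by simp
  have sint: "set_integrable lebesgue {0<..<1} (\<lambda>t. ?k t * G t)"
    using kG by (rule set_integrable_subset) auto
  then have int: "integrable ?M (\<lambda>t. ?k t * G t)"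
    by (simp add: integrable_restrict_space set_integrable_def)
  have "integral {0..1} (\<lambda>t. ?k t * G t) = integral {0<..<1} (\<lambda>t. ?k t * G t)"
    by (simp add: integral_open_interval_real)
  also have "\<dots> = (\<integral>t. ?k t * G t \<partial>?M)"
    unfolding set_lebesgue_integral_eq_integral(2)[OF sint, symmetric]
    by (simp add: set_lebesgue_integral_def integral_restrict_space)
  finally have "ennreal \<bar>integral {0..1} (\<lambda>t. ?k t * G t)\<bar> \<le> (\<integral>\<^sup>+t. ennreal (\<bar>?k t\<bar> * \<bar>G t\<bar>) \<partial>?M)"
    using integral_norm_bound_ennreal[OF int] by (simp add: abs_mult)
  also have "\<dots> \<le> ennreal (A1 \<alpha> l powr (1 - 1 / q)) *
      ennreal_powr (A2 \<alpha> l \<phi> * ennreal u + A3 \<alpha> l \<phi> * ennreal v) (1 / q)"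
  proof (rule weighted_power_mean[OF _ _ _ _ q A1_pos[OF l \<alpha>] kernel_nn_integral[OF l \<alpha>]])
    have "(\<integral>\<^sup>+t. ennreal (\<bar>?k t\<bar> * \<bar>G t\<bar> powr q) \<partial>?M)
        \<le> (\<integral>\<^sup>+t. ennreal (\<bar>?k t\<bar> * (t * \<phi> t)) * ennreal u
              + ennreal (\<bar>?k t\<bar> * ((1 - t) * \<phi> (1 - t))) * ennreal v \<partial>?M)"
    proof (rule nn_integral_mono)
      fix t assume "t \<in> space ?M"
      then have t: "0 < t" "t < 1" by auto
      then have pos: "0 \<le> t * \<phi> t" "0 \<le> (1 - t) * \<phi> (1 - t)"
        using \<phi>(2) by (auto intro!: mult_nonneg_nonneg simp: less_imp_le)
      have "\<bar>?k t\<bar> * \<bar>G t\<bar> powr q \<le> \<bar>?k t\<bar> * (t * \<phi> t * u + (1 - t) * \<phi> (1 - t) * v)"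
        using conv[OF t] by (intro mult_left_mono) auto
      also have "\<dots> = \<bar>?k t\<bar> * (t * \<phi> t) * u + \<bar>?k t\<bar> * ((1 - t) * \<phi> (1 - t)) * v"
        by (simp add: algebra_simps)
      finally have "ennreal (\<bar>?k t\<bar> * \<bar>G t\<bar> powr q)
          \<le> ennreal (\<bar>?k t\<bar> * (t * \<phi> t) * u + \<bar>?k t\<bar> * ((1 - t) * \<phi> (1 - t)) * v)"
        by (rule ennreal_leI)
      also have "\<dots> = ennreal (\<bar>?k t\<bar> * (t * \<phi> t)) * ennreal u
              + ennreal (\<bar>?k t\<bar> * ((1 - t) * \<phi> (1 - t))) * ennreal v"
        using uv mult_nonneg_nonneg[OF abs_ge_zero pos(1)] mult_nonneg_nonneg[OF abs_ge_zero pos(2)]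
        by (intro ennreal_mult_add_mult)
      finally show "ennreal (\<bar>?k t\<bar> * \<bar>G t\<bar> powr q) \<le> ennreal (\<bar>?k t\<bar> * (t * \<phi> t)) * ennreal u
              + ennreal (\<bar>?k t\<bar> * ((1 - t) * \<phi> (1 - t))) * ennreal v" .
    qed
    also have "\<dots> = (\<integral>\<^sup>+t. ennreal (\<bar>?k t\<bar> * (t * \<phi> t)) \<partial>?M) * ennreal u
        + (\<integral>\<^sup>+t. ennreal (\<bar>?k t\<bar> * ((1 - t) * \<phi> (1 - t))) \<partial>?M) * ennreal v"
      by (subst nn_integral_add) (auto simp: nn_integral_multc)
    also have "\<dots> = A2 \<alpha> l \<phi> * ennreal u + A3 \<alpha> l \<phi> * ennreal v"
      by (simp add: A2_def A3_def nn_integral_restrict_space)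
    finally show "(\<integral>\<^sup>+t. ennreal (\<bar>?k t\<bar> * \<bar>G t\<bar> powr q) \<partial>?M)
      \<le> A2 \<alpha> l \<phi> * ennreal u + A3 \<alpha> l \<phi> * ennreal v" .
  qed auto
  finally show ?thesis .
qed

section \<open>The contribution of one end point\<close>

text \<open>
  The expression inside the absolute value is \<open>\<bar>x - c\<bar> powr (\<alpha> + 2)\<close> times the integral of the kernel against
  \<open>f'' (t * x + (1 - t) * c)\<close>: this is the by-parts identity for \<open>F t = f (c + t * (x - c))\<close>,
  where each derivative contributes a factor \<open>x - c\<close> and the substitution turns the integral of
  \<open>t powr (\<alpha> - 1) * F t\<close> into a Riemann-Liouville integral. The difference \<open>x - c\<close> may have either
  sign, so that \<open>c = a\<close> and \<open>c = b\<close> are both covered; its sign survives only in the factor that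
  comes with \<open>f' x\<close>.
\<close>

lemma one_sided_bound:
  fixes f f' f'' \<phi> :: "real \<Rightarrow> real"
  assumes \<phi>: "\<phi> \<in> borel_measurable (lebesgue_on {0<..<1})" "\<forall>t\<in>{0<..<1}. 0 < \<phi> t"
    and l: "l \<in> {0..1}" and \<alpha>: "0 < \<alpha>" and q: "1 \<le> q"
    and derf: "\<And>t. t \<in> {a..b} \<Longrightarrow> (f has_real_derivative f' t) (at t)"
    and derf': "\<And>t. t \<in> {a..b} \<Longrightarrow> (f' has_real_derivative f'' t) (at t)"
    and intf'': "f'' absolutely_integrable_on {a..b}"
    and conv: "phi_convex_on \<phi> {a..b} (\<lambda>t. \<bar>f'' t\<bar> powr q)"
    and c: "c \<in> {a..b}" and x: "x \<in> {a..b}"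
  shows "ennreal \<bar>(l - 1) * (\<bar>x - c\<bar> powr \<alpha> * (x - c)) * f' x
        + (1 + \<alpha> - l) * \<bar>x - c\<bar> powr \<alpha> * f x + l * \<bar>x - c\<bar> powr \<alpha> * f c
        - \<alpha> * (\<alpha> + 1) * (LINT t:closed_segment c x|lebesgue. \<bar>t - c\<bar> powr (\<alpha> - 1) * f t)\<bar>
    \<le> ennreal (A1 \<alpha> l powr (1 - 1 / q)) * (ennreal (\<bar>x - c\<bar> powr (\<alpha> + 2)) *
        ennreal_powr (A2 \<alpha> l \<phi> * ennreal (\<bar>f'' x\<bar> powr q)
          + A3 \<alpha> l \<phi> * ennreal (\<bar>f'' c\<bar> powr q)) (1 / q))"
    (is "ennreal \<bar>?T\<bar> \<le> ennreal ?A * (ennreal ?H * ?R)")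
proof (cases "x = c")
  case True
  \<comment> \<open>The factor \<open>0 powr (\<alpha> + 2)\<close> makes the right-hand side \<open>0\<close> even if \<open>A2\<close> or \<open>A3\<close> is infinite.\<close>
  have "(LINT t:{c}|lebesgue. \<bar>t - c\<bar> powr (\<alpha> - 1) * f t) = 0"
    unfolding set_lebesgue_integral_def
    by (rule integral_eq_zero_AE) (auto simp: indicator_def)
  with True show ?thesis by simp
next
  case False
  define h where "h = x - c"
  have h: "h \<noteq> 0" using False by (simp add: h_def)
  have xh: "c + h = x" by (simp add: h_def)
  let ?\<gamma> = "\<lambda>t. c + t * h"
  let ?k = "\<lambda>t. t * (l - t powr \<alpha>)"
  have \<gamma>: "?\<gamma> t = t * x + (1 - t) * c" for t
    by (simp add: h_def algebra_simps)
  have seg: "closed_segment c x \<subseteq> {a..b}"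
    using c x by (intro closed_segment_subset) auto
  have img: "?\<gamma> ` {0..1} = closed_segment c x"
    by (force simp: closed_segment_def h_def algebra_simps)
  have \<gamma>in: "?\<gamma> t \<in> {a..b}" if "t \<in> {0..1}" for t
    using that img seg by blast
  have inj: "inj_on ?\<gamma> {0..1}" using h by (auto simp: inj_on_def)
  have der\<gamma>: "(?\<gamma> has_field_derivative h) (at t within S)" for t S
    by (auto intro!: derivative_eq_intros)
  have subst: "(\<lambda>t. g (?\<gamma> t)) absolutely_integrable_on {0..1}
      \<longleftrightarrow> g absolutely_integrable_on closed_segment c x"
    "(\<lambda>t. g (?\<gamma> t)) absolutely_integrable_on {0..1} \<Longrightarrow>
      \<bar>h\<bar> * integral {0..1} (\<lambda>t. g (?\<gamma> t)) = integral (closed_segment c x) g" for g :: "real \<Rightarrow> real"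
    using has_absolute_integral_change_of_variables_1'[OF _ der\<gamma> inj, of g] h
    by (auto simp: img absolutely_integrable_on_scaleR_iff[where 'a=real, simplified])
  have derF: "((\<lambda>t. f (?\<gamma> t)) has_real_derivative h * f' (?\<gamma> t)) (at t)" if "t \<in> {0..1}" for t
    using DERIV_chain2[OF derf[OF \<gamma>in[OF that]] der\<gamma>] by (simp add: mult.commute)
  have derF': "((\<lambda>t. h * f' (?\<gamma> t)) has_real_derivative h\<^sup>2 * f'' (?\<gamma> t)) (at t)" if "t \<in> {0..1}" for t
    using DERIV_cmult[OF DERIV_chain2[OF derf'[OF \<gamma>in[OF that]] der\<gamma>], of h]
    by (simp add: power2_eq_square mult_ac)
  have intG: "(\<lambda>t. f'' (?\<gamma> t)) absolutely_integrable_on {0..1}"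
    unfolding subst(1) by (rule set_integrable_subset[OF intf'' _ seg]) auto
  have contF: "continuous_on {0..1} (\<lambda>t. f (?\<gamma> t))" "continuous_on {0..1} (\<lambda>t. h * f' (?\<gamma> t))"
    using derF derF' by (auto intro!: DERIV_atLeastAtMost_imp_continuous_on)
  have intF'': "(\<lambda>t. h\<^sup>2 * f'' (?\<gamma> t)) absolutely_integrable_on {0..1}"
    using intG by (rule set_integrable_mult_right)
  have parts: "(\<lambda>t. ?k t * (h\<^sup>2 * f'' (?\<gamma> t))) absolutely_integrable_on {0..1}"
    "(\<lambda>t. t powr (\<alpha> - 1) * f (?\<gamma> t)) absolutely_integrable_on {0..1}"
    "integral {0..1} (\<lambda>t. ?k t * (h\<^sup>2 * f'' (?\<gamma> t))) =
      (l - 1) * (h * f' (?\<gamma> 1)) + (1 + \<alpha> - l) * f (?\<gamma> 1) + l * f (?\<gamma> 0)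
      - \<alpha> * (\<alpha> + 1) * integral {0..1} (\<lambda>t. t powr (\<alpha> - 1) * f (?\<gamma> t))"
    using kernel_by_parts[OF \<alpha> contF derF derF' intF''] by auto
  have kG: "(\<lambda>t. ?k t * f'' (?\<gamma> t)) absolutely_integrable_on {0..1}"
  proof -
    have "(\<lambda>t. 1 / h\<^sup>2 * (?k t * (h\<^sup>2 * f'' (?\<gamma> t)))) absolutely_integrable_on {0..1}"
      using parts(1) by (rule set_integrable_mult_right)
    moreover have "(\<lambda>t. 1 / h\<^sup>2 * (?k t * (h\<^sup>2 * f'' (?\<gamma> t)))) = (\<lambda>t. ?k t * f'' (?\<gamma> t))"
      using h by (simp add: fun_eq_iff)
    ultimately show ?thesis by metis
  qed
  let ?J = "integral {0..1} (\<lambda>t. t powr (\<alpha> - 1) * f (?\<gamma> t))"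
  have RL: "(LINT t:closed_segment c x|lebesgue. \<bar>t - c\<bar> powr (\<alpha> - 1) * f t) = \<bar>h\<bar> powr \<alpha> * ?J"
  proof -
    let ?g = "\<lambda>s. \<bar>s - c\<bar> powr (\<alpha> - 1) * f s"
    have e: "?g (?\<gamma> t) = \<bar>h\<bar> powr (\<alpha> - 1) * (t powr (\<alpha> - 1) * f (?\<gamma> t))" if "t \<in> {0..1}" for t
      using that by (simp add: abs_mult powr_mult)
    have ai: "(\<lambda>t. ?g (?\<gamma> t)) absolutely_integrable_on {0..1}"
      using set_integrable_mult_right[OF parts(2), of "\<bar>h\<bar> powr (\<alpha> - 1)"]
      by (subst set_integrable_cong[OF refl refl e]) auto
    have "(LINT t:closed_segment c x|lebesgue. ?g t) = integral (closed_segment c x) ?g"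
      using ai unfolding subst(1)[of ?g] by (rule set_lebesgue_integral_eq_integral(2))
    also have "\<dots> = \<bar>h\<bar> * integral {0..1} (\<lambda>t. ?g (?\<gamma> t))" using subst(2)[OF ai] by simp
    also have "integral {0..1} (\<lambda>t. ?g (?\<gamma> t)) = \<bar>h\<bar> powr (\<alpha> - 1) * ?J"
      by (subst integral_cong[OF e]) simp_all
    also have "\<bar>h\<bar> * (\<bar>h\<bar> powr (\<alpha> - 1) * ?J) = \<bar>h\<bar> powr \<alpha> * ?J"
      using h by (simp add: powr_diff)
    finally show ?thesis .
  qed
  have "?T = \<bar>h\<bar> powr \<alpha> * integral {0..1} (\<lambda>t. ?k t * (h\<^sup>2 * f'' (?\<gamma> t)))"
    unfolding RL parts(3) by (simp add: xh h_def[symmetric] algebra_simps)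
  also have "(\<lambda>t. ?k t * (h\<^sup>2 * f'' (?\<gamma> t))) = (\<lambda>t. h\<^sup>2 * (?k t * f'' (?\<gamma> t)))"
    by (simp add: fun_eq_iff)
  also have "\<bar>h\<bar> powr \<alpha> * integral {0..1} (\<lambda>t. h\<^sup>2 * (?k t * f'' (?\<gamma> t)))
      = ?H * integral {0..1} (\<lambda>t. ?k t * f'' (?\<gamma> t))"
    using h by (simp add: powr_add h_def)
  finally have "ennreal \<bar>?T\<bar> = ennreal ?H * ennreal \<bar>integral {0..1} (\<lambda>t. ?k t * f'' (?\<gamma> t))\<bar>"
    by (simp add: abs_mult ennreal_mult)
  also have "\<dots> \<le> ennreal ?H * (ennreal ?A * ?R)"
  proof (intro mult_left_mono kernel_integral_bound \<phi> l \<alpha> q intG kG)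
    fix t :: real assume "0 < t" "t < 1"
    then show "\<bar>f'' (?\<gamma> t)\<bar> powr q \<le>
        t * \<phi> t * \<bar>f'' x\<bar> powr q + (1 - t) * \<phi> (1 - t) * \<bar>f'' c\<bar> powr q"
      using conv c x unfolding phi_convex_on_def \<gamma> by auto
  qed auto
  finally show ?thesis by (simp add: mult_ac)
qed

section \<open>The inequality\<close>

text \<open>
  Up to the factor \<open>1 / (b - a)\<close>, \<open>S_frac\<close> is the sum of the one-sided expressions \<open>?T c\<close> at
  \<open>c = a\<close> and \<open>c = b\<close>; the constant \<open>\<alpha> * (\<alpha> + 1)\<close> in them is the quotient of \<open>Gamma (\<alpha> + 2)\<close> by
  \<open>Gamma \<alpha>\<close>.
\<close>

theorem theorem1:
  fixes \<phi> f :: "real \<Rightarrow> real" and I :: "real set" and a b q x l \<alpha> :: real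
  assumes "\<phi> \<in> borel_measurable (lebesgue_on {0<..<1})"
    and "\<forall>t\<in>{0<..<1}. 0 < \<phi> t"
    and "is_interval I" and "I \<subseteq> {0..}"
    and "f differentiable_on interior I"
    and "deriv f differentiable_on interior I"
    and "a \<in> interior I" and "b \<in> interior I" and "a < b"
    and "set_integrable lebesgue {a..b} (deriv (deriv f))"
    and "1 \<le> q"
    and "phi_convex_on \<phi> {a..b} (\<lambda>t. \<bar>deriv (deriv f) t\<bar> powr q)"
    and "x \<in> {a..b}" and "l \<in> {0..1}" and "0 < \<alpha>"
  shows "ennreal \<bar>S_frac f x l \<alpha> a b\<bar> \<le>
    ennreal (A1 \<alpha> l powr (1 - 1 / q)) *
      (ennreal ((x - a) powr (\<alpha> + 2) / (b - a)) *
         ennreal_powr (A2 \<alpha> l \<phi> * ennreal (\<bar>deriv (deriv f) x\<bar> powr q)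
                     + A3 \<alpha> l \<phi> * ennreal (\<bar>deriv (deriv f) a\<bar> powr q)) (1 / q)
     + ennreal ((b - x) powr (\<alpha> + 2) / (b - a)) *
         ennreal_powr (A2 \<alpha> l \<phi> * ennreal (\<bar>deriv (deriv f) x\<bar> powr q)
                     + A3 \<alpha> l \<phi> * ennreal (\<bar>deriv (deriv f) b\<bar> powr q)) (1 / q))"
proof -
  let ?f' = "deriv f" and ?f'' = "deriv (deriv f)"
  have ab: "{a..b} \<subseteq> interior I"
  proof -
    have "is_interval (interior I)"
      using \<open>is_interval I\<close> by (simp add: is_interval_convex_1)
    then have "t \<in> interior I" if "a \<le> t" "t \<le> b" for t
      using assms(7,8) that unfolding is_interval_1 by blast
    then show ?thesis by auto
  qed
  have der: "(g has_real_derivative deriv g t) (at t)"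
    if "g differentiable_on interior I" "t \<in> {a..b}" for g :: "real \<Rightarrow> real" and t
  proof -
    have "g differentiable at t"
      using that ab unfolding differentiable_on_eq_differentiable_at[OF open_interior] by blast
    then show ?thesis by (simp add: DERIV_deriv_iff_real_differentiable)
  qed
  define D where "D = b - a"
  have D: "0 < D" using \<open>a < b\<close> by (simp add: D_def)
  have x: "a \<le> x" "x \<le> b" using \<open>x \<in> {a..b}\<close> by auto
  let ?A = "ennreal (A1 \<alpha> l powr (1 - 1 / q))"
  let ?R = "\<lambda>c. ennreal_powr (A2 \<alpha> l \<phi> * ennreal (\<bar>?f'' x\<bar> powr q)
                     + A3 \<alpha> l \<phi> * ennreal (\<bar>?f'' c\<bar> powr q)) (1 / q)"
  let ?T = "\<lambda>c. (l - 1) * (\<bar>x - c\<bar> powr \<alpha> * (x - c)) * ?f' x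
        + (1 + \<alpha> - l) * \<bar>x - c\<bar> powr \<alpha> * f x + l * \<bar>x - c\<bar> powr \<alpha> * f c
        - \<alpha> * (\<alpha> + 1) * (LINT t:closed_segment c x|lebesgue. \<bar>t - c\<bar> powr (\<alpha> - 1) * f t)"
  have bound: "ennreal \<bar>?T c\<bar> \<le> ?A * (ennreal (\<bar>x - c\<bar> powr (\<alpha> + 2)) * ?R c)"
    if "c \<in> {a..b}" for c
    using one_sided_bound[OF assms(1,2,14,15,11) der[OF assms(5)] der[OF assms(6)]
        assms(10,12) that assms(13)] by simp
  have Gam: "Gamma (\<alpha> + 2) = \<alpha> * (\<alpha> + 1) * Gamma \<alpha>" "Gamma \<alpha> \<noteq> 0"
  proof -
    show "Gamma \<alpha> \<noteq> 0" using Gamma_real_pos[OF \<open>0 < \<alpha>\<close>] by simp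
    have "Gamma (\<alpha> + 1 + 1) = (\<alpha> + 1) * Gamma (\<alpha> + 1)" "Gamma (\<alpha> + 1) = \<alpha> * Gamma \<alpha>"
      using \<open>0 < \<alpha>\<close> by (intro Gamma_plus1; auto elim!: nonpos_Ints_cases)+
    then show "Gamma (\<alpha> + 2) = \<alpha> * (\<alpha> + 1) * Gamma \<alpha>"
      by (simp add: add.assoc)
  qed
  have La: "(LINT t:closed_segment a x|lebesgue. \<bar>t - a\<bar> powr (\<alpha> - 1) * f t) = Gamma \<alpha> * RL_minus \<alpha> x f a"
    using Gam(2) x unfolding RL_minus_def
    by (auto simp: closed_segment_eq_real_ivl intro!: set_lebesgue_integral_cong)
  have Lb: "(LINT t:closed_segment b x|lebesgue. \<bar>t - b\<bar> powr (\<alpha> - 1) * f t) = Gamma \<alpha> * RL_plus \<alpha> x f b"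
    using Gam(2) x unfolding RL_plus_def
    by (auto simp: closed_segment_eq_real_ivl intro!: set_lebesgue_integral_cong)
  have pow: "s powr (\<alpha> + 1) = s powr \<alpha> * s" if "0 \<le> s" for s :: real
    using that by (simp add: powr_add)
  have tri: "\<bar>(u + v) / D\<bar> \<le> 1 / D * \<bar>u\<bar> + 1 / D * \<bar>v\<bar>" for u v :: real
    using D abs_triangle_ineq[of u v] by (simp add: field_simps)
  have "S_frac f x l \<alpha> a b = (?T a + ?T b) / D"
  proof -
    have "\<bar>x - a\<bar> = x - a" "\<bar>x - b\<bar> = b - x" using x by auto
    then show ?thesis
      using x by (simp add: S_frac_def La Lb Gam(1) D_def[symmetric] pow)
        (simp add: add_divide_distrib diff_divide_distrib algebra_simps)
  qed
  then have "\<bar>S_frac f x l \<alpha> a b\<bar> \<le> 1 / D * \<bar>?T a\<bar> + 1 / D * \<bar>?T b\<bar>"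
    using tri[of "?T a" "?T b"] by simp
  then have "ennreal \<bar>S_frac f x l \<alpha> a b\<bar> \<le> ennreal (1 / D * \<bar>?T a\<bar> + 1 / D * \<bar>?T b\<bar>)"
    by (rule ennreal_leI)
  also have "\<dots> = ennreal (1 / D) * ennreal \<bar>?T a\<bar> + ennreal (1 / D) * ennreal \<bar>?T b\<bar>"
    using D by (intro ennreal_mult_add_mult) simp_all
  also have "\<dots> \<le> ennreal (1 / D) * (?A * (ennreal (\<bar>x - a\<bar> powr (\<alpha> + 2)) * ?R a))
      + ennreal (1 / D) * (?A * (ennreal (\<bar>x - b\<bar> powr (\<alpha> + 2)) * ?R b))"
    using bound \<open>a < b\<close> by (intro add_mono mult_left_mono) auto
  also have "\<dots> = ?A * ((ennreal (\<bar>x - a\<bar> powr (\<alpha> + 2)) * ennreal (1 / D)) * ?R a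
      + (ennreal (\<bar>x - b\<bar> powr (\<alpha> + 2)) * ennreal (1 / D)) * ?R b)"
    by (simp add: distrib_left mult_ac)
  also have "ennreal (\<bar>x - a\<bar> powr (\<alpha> + 2)) * ennreal (1 / D) = ennreal ((x - a) powr (\<alpha> + 2) / (b - a))"
    using x D by (simp flip: ennreal_mult D_def)
  also have "ennreal (\<bar>x - b\<bar> powr (\<alpha> + 2)) * ennreal (1 / D) = ennreal ((b - x) powr (\<alpha> + 2) / (b - a))"
    using x D by (simp flip: ennreal_mult D_def)
  finally show ?thesis .
qed

end
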